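(* Let $\Sigma$ be a vertical h-grim reaper of $\mathbb{H}^2\times\mathbb{R}$ parametrized by $\Psi(s,t)=(x(s),y(s),t)$, $t\in\mathbb{R}$, where the generating curve $\alpha(s)=(x(s),y(s))$ satisfies $x'(s)=y(s)\cos\theta(s)$, $y'(s)=y(s)\sin\theta(s)$ for a smooth function $\theta$. Then $\theta$ satisfies $$\theta'=\cos\theta-\frac{2x\sin\theta}{y}.$$
   Context: $\mathbb{H}^2\times\mathbb{R}$ is $\{(x,y,z)\in\mathbb{R}^3: y>0\}$ with metric $\frac{dx^2+dy^2}{y^2}+dz^2$. For an orientable immersed surface $\Sigma$ with unit normal $N$, $H$ denotes the mean curvature with respect to $N$, i.e. half the trace of the second fundamental form $\langle N,\overline\nabla_{\cdot}\,\cdot\rangle$. $\Sigma$ is an h-translator if $H=\langle N,x\partial_x+y\partial_y\rangle$. A vertical h-grim reaper is an h-translator invariant by all vertical translations $(x,y,z)\mapsto(x,y,z+t)$, $t\in\mathbb{R}$. *)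

theory Defs
  imports "HOL-Analysis.Analysis"
begin

primrec times_diff_on ::
    "nat \<Rightarrow> 'a set \<Rightarrow> ('a::euclidean_space \<Rightarrow> 'b::real_normed_vector) \<Rightarrow> bool" where
  "times_diff_on 0 U f \<longleftrightarrow> continuous_on U f"
| "times_diff_on (Suc k) U f \<longleftrightarrow>
     (\<forall>p\<in>U. f differentiable (at p)) \<and>
     (\<forall>v. times_diff_on k U (\<lambda>p. frechet_derivative f (at p) v))"

text \<open>The derivatives are two-sided, so the following is meant for open \<open>U\<close>.\<close>

definition smooth_on ::
    "'a set \<Rightarrow> ('a::euclidean_space \<Rightarrow> 'b::real_normed_vector) \<Rightarrow> bool" where
  "smooth_on U f \<longleftrightarrow> (\<forall>k. times_diff_on k U f)"

definition partial ::
    "'n::finite \<Rightarrow> (real^'n \<Rightarrow> 'b::real_normed_vector) \<Rightarrow> real^'n \<Rightarrow> 'b" where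
  "partial i f p = frechet_derivative f (at p) (axis i 1)"

text \<open>
  A metric on an open subset of \<open>real^'n\<close> is a function \<open>g\<close> such that \<open>g p u v\<close> is the inner
  product at the point \<open>p\<close> of the tangent vectors with components \<open>u\<close> and \<open>v\<close> in the
  coordinate frame.
\<close>

type_synonym 'n metric = "real^'n \<Rightarrow> real^'n \<Rightarrow> real^'n \<Rightarrow> real"

definition metric_matrix :: "'n::finite metric \<Rightarrow> real^'n \<Rightarrow> real^'n^'n" where
  "metric_matrix g p = (\<chi> i j. g p (axis i 1) (axis j 1))"

definition christoffel ::
    "'n::finite metric \<Rightarrow> real^'n \<Rightarrow> 'n \<Rightarrow> 'n \<Rightarrow> 'n \<Rightarrow> real" where
  "christoffel g p k i j =
     (\<Sum>l\<in>UNIV. matrix_inv (metric_matrix g p) $ k $ l *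
       (partial i (\<lambda>q. metric_matrix g q $ j $ l) p +
        partial j (\<lambda>q. metric_matrix g q $ i $ l) p -
        partial l (\<lambda>q. metric_matrix g q $ i $ j) p)) / 2"

text \<open>
  The Levi-Civita covariant derivative, in the direction of the \<open>i\<close>-th parameter, of a vector
  field \<open>V\<close> along the map \<open>F\<close>.
\<close>

definition covariant_partial ::
    "'n::finite metric \<Rightarrow> (real^'m \<Rightarrow> real^'n) \<Rightarrow> 'm::finite \<Rightarrow> (real^'m \<Rightarrow> real^'n)
      \<Rightarrow> real^'m \<Rightarrow> real^'n" where
  "covariant_partial g F i V p =
     (\<chi> k. partial i V p $ k +
       (\<Sum>a\<in>UNIV. \<Sum>b\<in>UNIV. christoffel g (F p) k a b * partial i F p $ a * V p $ b))"

definition immersed_surface ::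
    "(real^'n) set \<Rightarrow> (real^2) set \<Rightarrow> (real^2 \<Rightarrow> real^'n::finite) \<Rightarrow> bool" where
  "immersed_surface M U F \<longleftrightarrow>
     open U \<and> smooth_on U F \<and> F ` U \<subseteq> M \<and> (\<forall>p\<in>U. inj (frechet_derivative F (at p)))"

definition unit_normal ::
    "'n::finite metric \<Rightarrow> (real^2) set \<Rightarrow> (real^2 \<Rightarrow> real^'n) \<Rightarrow> (real^2 \<Rightarrow> real^'n) \<Rightarrow> bool" where
  "unit_normal g U F N \<longleftrightarrow>
     continuous_on U N \<and>
     (\<forall>p\<in>U. g (F p) (N p) (N p) = 1 \<and>
        (\<forall>w. g (F p) (N p) (frechet_derivative F (at p) w) = 0))"

definition first_fundamental_form ::
    "'n::finite metric \<Rightarrow> (real^2 \<Rightarrow> real^'n) \<Rightarrow> real^2 \<Rightarrow> real^2^2" where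
  "first_fundamental_form g F p = (\<chi> i j. g (F p) (partial i F p) (partial j F p))"

definition second_fundamental_form ::
    "'n::finite metric \<Rightarrow> (real^2 \<Rightarrow> real^'n) \<Rightarrow> (real^2 \<Rightarrow> real^'n) \<Rightarrow> real^2 \<Rightarrow> real^2^2" where
  "second_fundamental_form g F N p =
     (\<chi> i j. g (F p) (N p) (covariant_partial g F i (partial j F) p))"

text \<open>The trace of the second fundamental form is taken with respect to the induced metric.\<close>

definition mean_curvature ::
    "'n::finite metric \<Rightarrow> (real^2 \<Rightarrow> real^'n) \<Rightarrow> (real^2 \<Rightarrow> real^'n) \<Rightarrow> real^2 \<Rightarrow> real" where
  "mean_curvature g F N p =
     trace (matrix_inv (first_fundamental_form g F p) ** second_fundamental_form g F N p) / 2"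

definition H2xR :: "(real^3) set" where
  "H2xR = {p. p $ 2 > 0}"

definition H2xR_metric :: "3 metric" where
  "H2xR_metric p u v = (u $ 1 * v $ 1 + u $ 2 * v $ 2) / (p $ 2)\<^sup>2 + u $ 3 * v $ 3"

definition h_field :: "real^3 \<Rightarrow> real^3" where
  "h_field p = vector [p $ 1, p $ 2, 0]"

definition h_translator ::
    "(real^2) set \<Rightarrow> (real^2 \<Rightarrow> real^3) \<Rightarrow> (real^2 \<Rightarrow> real^3) \<Rightarrow> bool" where
  "h_translator U F N \<longleftrightarrow>
     immersed_surface H2xR U F \<and> unit_normal H2xR_metric U F N \<and>
     (\<forall>p\<in>U. mean_curvature H2xR_metric F N p = H2xR_metric (F p) (N p) (h_field (F p)))"

definition vertical_h_grim_reaper ::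
    "(real^2) set \<Rightarrow> (real^2 \<Rightarrow> real^3) \<Rightarrow> (real^2 \<Rightarrow> real^3) \<Rightarrow> bool" where
  "vertical_h_grim_reaper U F N \<longleftrightarrow>
     h_translator U F N \<and> (\<forall>t. (\<lambda>q. q + vector [0, 0, t]) ` F ` U = F ` U)"

end

theory Submission
  imports Defs
begin

text \<open>
  The surface is the cylinder over the curve \<open>\<alpha> = (x, y)\<close> of the hyperbolic plane, and the hypotheses
  on \<open>x'\<close> and \<open>y'\<close> say that \<open>\<alpha>\<close> has hyperbolic unit speed and makes the angle \<open>\<theta>\<close> with the
  horizontal. Since the metric is a product, the two coordinate fields of the cylinder are
  orthonormal (\<open>first_fundamental_form_cylinder\<close>) and the vertical lines are geodesics of the ambient
  space, so twice the mean curvature is the curvature of \<open>\<alpha>\<close> with respect to \<open>N\<close>.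

  For the unit normal \<open>(- y sin \<theta>, y cos \<theta>)\<close> of \<open>\<alpha>\<close>, the covariant acceleration of \<open>\<alpha>\<close> is
  \<open>\<theta>' + cos \<theta>\<close> times that normal (\<open>covariant_partial_cylinder\<close>): the Euclidean turning \<open>\<theta>'\<close> plus the
  contribution \<open>cos \<theta>\<close> of the Christoffel symbols of the half-plane. The inner product of the normal with
  the field \<open>x \<partial>\<^sub>x + y \<partial>\<^sub>y\<close> is \<open>cos \<theta> - x sin \<theta> / y\<close>. The normal \<open>N\<close> is only determined up to sign,
  but it enters both sides of the translator equation linearly through the same nonzero factor
  (\<open>unit_normal_cylinder\<close>), which cancels. What remains is
  \<open>(\<theta>' + cos \<theta>) / 2 = cos \<theta> - x sin \<theta> / y\<close>, the asserted equation.
\<close>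

section \<open>Partial derivatives and inverse matrices\<close>

lemma partial_eq:
  assumes "(f has_derivative f') (at p)"
  shows "partial i f p = f' (axis i 1)"
  unfolding partial_def using frechet_derivative_at[OF assms] by simp

lemma has_derivative_vector3:
  fixes a b c :: "'a::real_normed_vector \<Rightarrow> real"
  assumes "(a has_derivative a') F" "(b has_derivative b') F" "(c has_derivative c') F"
  shows "((\<lambda>q. vector [a q, b q, c q] :: real^3) has_derivative
          (\<lambda>h. vector [a' h, b' h, c' h])) F"
proof -
  have vector_as_sum: "(vector [u, v, w] :: real^3) =
      u *\<^sub>R axis 1 1 + v *\<^sub>R axis 2 1 + w *\<^sub>R axis 3 1" for u v w
    by (simp add: vec_eq_iff forall_3 axis_def)
  show ?thesis
    unfolding vector_as_sum by (intro derivative_intros assms)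
qed

lemma has_derivative_of_coordinate:
  fixes f :: "real \<Rightarrow> real" and p :: "real^'n"
  assumes "(f has_real_derivative d) (at (p $ i))"
  shows "((\<lambda>q. f (q $ i)) has_derivative (\<lambda>h. d * h $ i)) (at p)"
proof -
  have "((\<lambda>q::real^'n. q $ i) has_derivative (\<lambda>h. h $ i)) (at p)"
    by (rule bounded_linear_imp_has_derivative[OF bounded_linear_vec_nth])
  from has_derivative_compose[OF this, of f "(*) d"] assms
  show ?thesis by (simp add: has_field_derivative_def)
qed

lemma matrix_inv_eqI:
  fixes A B :: "real^'n^'n"
  assumes "A ** B = mat 1"
  shows "matrix_inv A = B"
proof -
  from assms have "B ** A = mat 1"
    by (rule matrix_left_right_inverse[THEN iffD1])
  with assms have "\<exists>C. A ** C = mat 1 \<and> C ** A = mat 1"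
    by blast
  then have "matrix_inv A ** A = mat 1"
    unfolding matrix_inv_def by (metis (mono_tags, lifting) someI_ex)
  then show ?thesis
    using assms by (metis matrix_mul_assoc matrix_mul_lid matrix_mul_rid)
qed

section \<open>The Levi-Civita connection of the ambient space\<close>

lemma H2xR_metric_matrix_nth:
  "metric_matrix H2xR_metric q $ i $ j =
     (if i = j then if i = 3 then 1 else 1 / (q $ 2)\<^sup>2 else 0)"
  using exhaust_3[of i] exhaust_3[of j]
  by (auto simp: metric_matrix_def H2xR_metric_def axis_def)

lemma matrix_inv_H2xR_metric:
  assumes "q $ 2 \<noteq> 0"
  shows "matrix_inv (metric_matrix H2xR_metric q) =
     (\<chi> i j. if i = j then if i = 3 then 1 else (q $ 2)\<^sup>2 else 0)"
  by (rule matrix_inv_eqI)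
     (use assms in \<open>simp_all add: vec_eq_iff matrix_matrix_mult_def H2xR_metric_matrix_nth
        mat_def forall_3 sum_3\<close>)

lemma partial_H2xR_metric_matrix:
  assumes "p $ 2 \<noteq> 0"
  shows "partial l (\<lambda>q. metric_matrix H2xR_metric q $ i $ j) p =
     (if i = j \<and> i \<noteq> 3 \<and> l = 2 then - 2 / (p $ 2) ^ 3 else 0)"
proof (cases "i = j \<and> i \<noteq> 3")
  case True
  have "((\<lambda>u::real. 1 / u\<^sup>2) has_real_derivative - 2 / (p $ 2) ^ 3) (at (p $ 2))"
    using assms
    by (auto intro!: derivative_eq_intros simp: field_simps power2_eq_square power3_eq_cube)
  from partial_eq[OF has_derivative_of_coordinate[OF this], of l] True
  show ?thesis by (auto simp: H2xR_metric_matrix_nth axis_def)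
next
  case False
  then have "(\<lambda>q. metric_matrix H2xR_metric q $ i $ j) = (\<lambda>q. if i = j then 1 else 0)"
    by (auto simp: H2xR_metric_matrix_nth)
  with False show ?thesis
    using partial_eq[OF has_derivative_const] by auto
qed

text \<open>
  The vertical direction is a flat factor, so only the Christoffel symbols of the half-plane
  survive.
\<close>

lemma christoffel_H2xR:
  assumes "p $ 2 \<noteq> 0"
  shows "christoffel H2xR_metric p k a b =
     (if k = 1 \<and> (a = 1 \<and> b = 2 \<or> a = 2 \<and> b = 1) then - 1 / p $ 2
      else if k = 2 \<and> a = 1 \<and> b = 1 then 1 / p $ 2
      else if k = 2 \<and> a = 2 \<and> b = 2 then - 1 / p $ 2
      else 0)"
  using exhaust_3[of k] exhaust_3[of a] exhaust_3[of b] assms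
  by (elim disjE)
     (simp_all add: christoffel_def matrix_inv_H2xR_metric partial_H2xR_metric_matrix sum_3
        power2_eq_square power3_eq_cube)

section \<open>The curvature of vertical cylinders\<close>

text \<open>
  The cylinder is described by the curve alone, with neither a choice of normal nor the translator
  equation, so that its curvature is computed for an arbitrary field \<open>N\<close>.
\<close>

locale vertical_cylinder =
  fixes I :: "real set" and x y \<theta> :: "real \<Rightarrow> real" and F :: "real^2 \<Rightarrow> real^3"
  assumes open_I: "open I"
    and x_deriv: "\<And>s. s \<in> I \<Longrightarrow> (x has_real_derivative y s * cos (\<theta> s)) (at s)"
    and y_deriv: "\<And>s. s \<in> I \<Longrightarrow> (y has_real_derivative y s * sin (\<theta> s)) (at s)"
    and y_pos: "\<And>s. s \<in> I \<Longrightarrow> y s > 0"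
    and F_eq: "F = (\<lambda>p. vector [x (p $ 1), y (p $ 1), p $ 2])"
begin

lemma F_nth:
  "F p $ 1 = x (p $ 1)" "F p $ 2 = y (p $ 1)" "F p $ 3 = p $ 2"
  by (simp_all add: F_eq)

lemma frechet_derivative_cylinder:
  assumes "p $ 1 \<in> I"
  shows "frechet_derivative F (at p) =
     (\<lambda>h. vector [y (p $ 1) * cos (\<theta> (p $ 1)) * h $ 1, y (p $ 1) * sin (\<theta> (p $ 1)) * h $ 1, h $ 2])"
proof -
  have "(F has_derivative (\<lambda>h. vector [y (p $ 1) * cos (\<theta> (p $ 1)) * h $ 1,
      y (p $ 1) * sin (\<theta> (p $ 1)) * h $ 1, h $ 2])) (at p)"
    unfolding F_eq
    by (intro has_derivative_vector3 has_derivative_of_coordinate x_deriv y_deriv assms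
        bounded_linear_imp_has_derivative[OF bounded_linear_vec_nth])
  from frechet_derivative_at[OF this] show ?thesis by simp
qed

lemma partial_cylinder:
  assumes "p $ 1 \<in> I"
  shows "partial 1 F p = vector [y (p $ 1) * cos (\<theta> (p $ 1)), y (p $ 1) * sin (\<theta> (p $ 1)), 0]"
    and "partial 2 F p = vector [0, 0, 1]"
  by (simp_all add: partial_def frechet_derivative_cylinder[OF assms] axis_def)

lemma first_fundamental_form_cylinder:
  assumes "p $ 1 \<in> I"
  shows "first_fundamental_form H2xR_metric F p = mat 1"
proof -
  have "y (p $ 1) * y (p $ 1) * (cos (\<theta> (p $ 1)))\<^sup>2 + y (p $ 1) * y (p $ 1) * (sin (\<theta> (p $ 1)))\<^sup>2
      = y (p $ 1) * y (p $ 1)"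
    by (metis distrib_left mult.right_neutral sin_cos_squared_add2)
  then show ?thesis
    using y_pos[OF assms]
    by (simp add: first_fundamental_form_def vec_eq_iff forall_2 mat_def partial_cylinder[OF assms]
        H2xR_metric_def F_nth field_simps power2_eq_square)
qed

text \<open>
  The closed forms of the first partials hold on a whole strip, which is open, and may therefore be
  differentiated again.
\<close>

lemma partial_partial_cylinder:
  assumes p: "p $ 1 \<in> I" and \<theta>: "(\<theta> has_real_derivative \<theta>') (at (p $ 1))"
  shows "partial 1 (partial 1 F) p =
      vector [y (p $ 1) * (sin (\<theta> (p $ 1)) * cos (\<theta> (p $ 1)) - \<theta>' * sin (\<theta> (p $ 1))),
              y (p $ 1) * ((sin (\<theta> (p $ 1)))\<^sup>2 + \<theta>' * cos (\<theta> (p $ 1))), 0]"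
    and "partial 2 (partial 2 F) p = 0"
proof -
  have open_strip: "open {q::real^2. q $ 1 \<in> I}"
    using open_vimage_vec_nth[OF open_I] by (simp add: vimage_def)
  let ?s = "p $ 1"
  have "((\<lambda>q::real^2. vector [y (q $ 1) * cos (\<theta> (q $ 1)), y (q $ 1) * sin (\<theta> (q $ 1)), 0] :: real^3)
      has_derivative (\<lambda>h. vector [(y ?s * (sin (\<theta> ?s) * cos (\<theta> ?s) - \<theta>' * sin (\<theta> ?s))) * h $ 1,
        (y ?s * ((sin (\<theta> ?s))\<^sup>2 + \<theta>' * cos (\<theta> ?s))) * h $ 1, 0])) (at p)"
    by (intro has_derivative_vector3 has_derivative_const
          has_derivative_of_coordinate[where f = "\<lambda>s. y s * cos (\<theta> s)"]
          has_derivative_of_coordinate[where f = "\<lambda>s. y s * sin (\<theta> s)"])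
       (auto intro!: derivative_eq_intros y_deriv p \<theta> simp: algebra_simps power2_eq_square)
  then have "(partial 1 F has_derivative
      (\<lambda>h. vector [(y ?s * (sin (\<theta> ?s) * cos (\<theta> ?s) - \<theta>' * sin (\<theta> ?s))) * h $ 1,
        (y ?s * ((sin (\<theta> ?s))\<^sup>2 + \<theta>' * cos (\<theta> ?s))) * h $ 1, 0])) (at p)"
    by (rule has_derivative_transform_within_open[OF _ open_strip])
       (use p in \<open>simp_all add: partial_cylinder\<close>)
  from partial_eq[OF this]
  show "partial 1 (partial 1 F) p =
      vector [y ?s * (sin (\<theta> ?s) * cos (\<theta> ?s) - \<theta>' * sin (\<theta> ?s)),
              y ?s * ((sin (\<theta> ?s))\<^sup>2 + \<theta>' * cos (\<theta> ?s)), 0]"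
    by (simp add: axis_def)
  have "(partial 2 F has_derivative (\<lambda>h. 0)) (at p)"
    by (rule has_derivative_transform_within_open[OF has_derivative_const open_strip])
       (use p in \<open>simp_all add: partial_cylinder\<close>)
  from partial_eq[OF this] show "partial 2 (partial 2 F) p = 0" by simp
qed

text \<open>
  The acceleration of a unit speed curve is normal to the curve. In coordinates, the terms
  \<open>y' cos \<theta>\<close> of \<open>x''\<close> and \<open>y' sin \<theta>\<close> of \<open>y''\<close> add up with the Christoffel terms \<open>- 2 x' y' / y\<close> and
  \<open>((x')\<^sup>2 - (y')\<^sup>2) / y\<close> to \<open>cos \<theta>\<close> times the normal, and the other terms of \<open>x''\<close> and \<open>y''\<close> are
  \<open>\<theta>'\<close> times the normal.
\<close>

lemma covariant_partial_cylinder: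
  assumes p: "p $ 1 \<in> I" and \<theta>: "(\<theta> has_real_derivative \<theta>') (at (p $ 1))"
  shows "covariant_partial H2xR_metric F 1 (partial 1 F) p =
      (\<theta>' + cos (\<theta> (p $ 1))) *\<^sub>R
        vector [- (y (p $ 1) * sin (\<theta> (p $ 1))), y (p $ 1) * cos (\<theta> (p $ 1)), 0]"
    and "covariant_partial H2xR_metric F 2 (partial 2 F) p = 0"
  using y_pos[OF p]
  by (simp_all add: covariant_partial_def vec_eq_iff forall_3 sum_3 christoffel_H2xR F_nth
      partial_cylinder[OF p] partial_partial_cylinder[OF p \<theta>] field_simps power2_eq_square)

text \<open>
  The first fundamental form is the identity and the vertical lines are geodesics, so the trace
  reduces to the component of the acceleration of the curve along \<open>N\<close>.
\<close>

lemma mean_curvature_cylinder: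
  assumes p: "p $ 1 \<in> I" and \<theta>: "(\<theta> has_real_derivative \<theta>') (at (p $ 1))"
  shows "mean_curvature H2xR_metric F N p =
     (\<theta>' + cos (\<theta> (p $ 1))) *
       (N p $ 2 * cos (\<theta> (p $ 1)) - N p $ 1 * sin (\<theta> (p $ 1))) / (2 * y (p $ 1))"
proof -
  have "matrix_inv (mat 1 :: real^2^2) = mat 1"
    by (rule matrix_inv_eqI) simp_all
  then have "mean_curvature H2xR_metric F N p =
      H2xR_metric (F p) (N p) (covariant_partial H2xR_metric F 1 (partial 1 F) p) / 2"
    by (simp add: mean_curvature_def first_fundamental_form_cylinder[OF p] trace_def sum_2
        second_fundamental_form_def covariant_partial_cylinder[OF p \<theta>] H2xR_metric_def)
  moreover have "H2xR_metric (F p) (N p) (covariant_partial H2xR_metric F 1 (partial 1 F) p) =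
      y (p $ 1) * ((\<theta>' + cos (\<theta> (p $ 1))) *
        (N p $ 2 * cos (\<theta> (p $ 1)) - N p $ 1 * sin (\<theta> (p $ 1)))) / (y (p $ 1))\<^sup>2"
    by (simp add: covariant_partial_cylinder[OF p \<theta>] H2xR_metric_def F_nth algebra_simps)
  ultimately show ?thesis
    using y_pos[OF p] by (simp add: power2_eq_square)
qed

text \<open>
  Orthogonality to the vertical direction and to the curve puts \<open>N\<close> on a line, and its unit length
  excludes \<open>0\<close>. In fact \<open>c = \<plusminus> y\<close>, but for an equation that is linear in \<open>N\<close> it is enough that
  \<open>c\<close> can be cancelled.
\<close>

lemma unit_normal_cylinder:
  assumes N: "unit_normal H2xR_metric U F N" and p: "p \<in> U" "p $ 1 \<in> I"
  obtains c where "c \<noteq> 0"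
    and "N p = c *\<^sub>R vector [- sin (\<theta> (p $ 1)), cos (\<theta> (p $ 1)), 0]"
proof -
  let ?y = "y (p $ 1)" and ?\<theta> = "\<theta> (p $ 1)"
  note y = y_pos[OF p(2)]
  have normal: "H2xR_metric (F p) (N p) (partial i F p) = 0" for i
    using N p by (simp add: unit_normal_def partial_def)
  have unit: "H2xR_metric (F p) (N p) (N p) = 1"
    using N p by (simp add: unit_normal_def)
  have N3: "N p $ 3 = 0"
    using normal[of 2] by (simp add: partial_cylinder[OF p(2)] H2xR_metric_def)
  have "?y * (N p $ 1 * cos ?\<theta> + N p $ 2 * sin ?\<theta>) = 0"
    using normal[of 1] y
    by (simp add: partial_cylinder[OF p(2)] H2xR_metric_def F_nth algebra_simps)
  then have orth: "N p $ 1 * cos ?\<theta> + N p $ 2 * sin ?\<theta> = 0"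
    using y by simp
  define c where "c = N p $ 2 * cos ?\<theta> - N p $ 1 * sin ?\<theta>"
  have trig: "(sin ?\<theta>)\<^sup>2 + (cos ?\<theta>)\<^sup>2 = 1" by simp
  have "N p $ 1 = - c * sin ?\<theta>" "N p $ 2 = c * cos ?\<theta>"
    using orth trig unfolding c_def by algebra+
  with N3 have N_eq: "N p = c *\<^sub>R vector [- sin ?\<theta>, cos ?\<theta>, 0]"
    by (simp add: vec_eq_iff forall_3)
  moreover have "c \<noteq> 0"
    using unit N_eq by (auto simp: H2xR_metric_def)
  ultimately show thesis using that by blast
qed

end

section \<open>The equation of vertical h-grim reapers\<close>

theorem theorem6p1:
  fixes I :: "real set" and x y \<theta> :: "real \<Rightarrow> real" and N :: "real^2 \<Rightarrow> real^3"
  assumes "open I" and "is_interval I"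
    and "smooth_on I \<theta>"
    and "\<And>s. s \<in> I \<Longrightarrow> (x has_real_derivative y s * cos (\<theta> s)) (at s)"
    and "\<And>s. s \<in> I \<Longrightarrow> (y has_real_derivative y s * sin (\<theta> s)) (at s)"
    and "vertical_h_grim_reaper {p. p $ 1 \<in> I} (\<lambda>p. vector [x (p $ 1), y (p $ 1), p $ 2]) N"
  shows "\<forall>s\<in>I. (\<theta> has_real_derivative cos (\<theta> s) - 2 * x s * sin (\<theta> s) / y s) (at s)"
proof
  fix s assume s: "s \<in> I"
  define F :: "real^2 \<Rightarrow> real^3" where "F = (\<lambda>p. vector [x (p $ 1), y (p $ 1), p $ 2])"
  have translator: "h_translator {p. p $ 1 \<in> I} F N"
    using assms(6) by (simp add: vertical_h_grim_reaper_def F_def)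
  have y_pos: "y r > 0" if "r \<in> I" for r
  proof -
    have "F (vector [r, 0]) \<in> H2xR"
      using translator that by (auto simp: h_translator_def immersed_surface_def)
    then show ?thesis by (simp add: H2xR_def F_def)
  qed
  interpret vertical_cylinder I x y \<theta> F
    by unfold_locales (use assms y_pos in \<open>auto simp: F_def\<close>)
  have "times_diff_on (Suc 0) I \<theta>"
    using assms(3) by (simp only: smooth_on_def)
  with s obtain \<theta>' where \<theta>': "(\<theta> has_real_derivative \<theta>') (at s)"
    by (auto simp: real_differentiable_def)
  \<comment> \<open>The equation at one point of the vertical line over \<open>s\<close> suffices.\<close>
  define p :: "real^2" where "p = vector [s, 0]"
  have p: "p $ 1 = s" by (simp add: p_def)
  have N: "unit_normal H2xR_metric {p. p $ 1 \<in> I} F N"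
    using translator by (simp add: h_translator_def)
  obtain c where c: "c \<noteq> 0" and N_eq: "N p = c *\<^sub>R vector [- sin (\<theta> s), cos (\<theta> s), 0]"
    using unit_normal_cylinder[OF N, of p] p s by auto
  have "mean_curvature H2xR_metric F N p = H2xR_metric (F p) (N p) (h_field (F p))"
    using translator p s by (simp add: h_translator_def)
  then have "(\<theta>' + cos (\<theta> s)) * (c * (cos (\<theta> s))\<^sup>2 + c * (sin (\<theta> s))\<^sup>2) / (2 * y s) =
      c * (y s * cos (\<theta> s) - x s * sin (\<theta> s)) / (y s)\<^sup>2"
    using mean_curvature_cylinder[of p \<theta>' N] \<theta>' s
    by (simp add: p N_eq H2xR_metric_def h_field_def F_nth algebra_simps power2_eq_square)
  moreover have "c * (cos (\<theta> s))\<^sup>2 + c * (sin (\<theta> s))\<^sup>2 = c"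
    by (metis distrib_left mult.right_neutral sin_cos_squared_add2)
  ultimately have "c * ((\<theta>' + cos (\<theta> s)) / (2 * y s)) =
      c * ((y s * cos (\<theta> s) - x s * sin (\<theta> s)) / (y s)\<^sup>2)"
    by (simp add: ac_simps)
  then have "(\<theta>' + cos (\<theta> s)) / (2 * y s) =
      (y s * cos (\<theta> s) - x s * sin (\<theta> s)) / (y s)\<^sup>2"
    by (rule mult_left_cancel[OF c, THEN iffD1])
  also have "\<dots> = (2 * (cos (\<theta> s) - x s * sin (\<theta> s) / y s)) / (2 * y s)"
    using y_pos[OF s] by (simp add: field_simps power2_eq_square)
  finally have "\<theta>' + cos (\<theta> s) = 2 * (cos (\<theta> s) - x s * sin (\<theta> s) / y s)"
    using y_pos[OF s] by simp
  then have "\<theta>' = cos (\<theta> s) - 2 * x s * sin (\<theta> s) / y s"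
    by (simp add: algebra_simps)
  with \<theta>' show "(\<theta> has_real_derivative cos (\<theta> s) - 2 * x s * sin (\<theta> s) / y s) (at s)"
    by simp
qed

end
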